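(* For an oriented graph $G^\sigma$ with $n$ vertices and $m$ arcs, $$I_{R_S}^1(G^\sigma)\le 1-\frac1n.$$
   Context: $G$ is a simple undirected graph with vertices $v_1,\dots,v_n$ of degrees $d_1,\dots,d_n$, and $G^\sigma$ is an oriented graph of $G$ with the orientation $\sigma$ (each edge receives one direction). The skew Randić matrix is the $n\times n$ matrix $R_s(G^\sigma)=[(r_s)_{ij}]$ with $(r_s)_{ij}=(d_id_j)^{-1/2}$ and $(r_s)_{ji}=-(d_id_j)^{-1/2}$ if $\langle v_i,v_j\rangle$ is an arc of $G^\sigma$, and $(r_s)_{ij}=(r_s)_{ji}=0$ if there is no arc between $v_i$ and $v_j$. Let $\rho_1,\dots,\rho_n$ be its (complex) eigenvalues and put $p_i=|\rho_i|/\sum_{j=1}^n|\rho_j|$. The generalized graph entropy $I_{R_S}^1(G^\sigma)$ is $I_{R_S}^1(G^\sigma)=\sum_{i=1}^n p_i(1-p_i)$. *)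

theory Defs
  imports
    "Jordan_Normal_Form.Char_Poly"
    "HOL-Computational_Algebra.Polynomial_Factorial"
    "Graph_Theory.Graph_Theory"
begin

text \<open>
  A finite simple undirected graph is a \<^locale>\<open>pair_graph\<close>: finite, loop-free, without parallel
  arcs, with every edge present as the two arcs \<open>(u, w)\<close> and \<open>(w, u)\<close>. An orientation keeps
  exactly one of these two arcs for each edge.
\<close>

definition orientation :: "'v pair_pre_digraph \<Rightarrow> 'v pair_pre_digraph \<Rightarrow> bool" where
  "orientation G D \<longleftrightarrow>
     pverts D = pverts G \<and> parcs D \<subseteq> parcs G \<and>
     (\<forall>(u, w) \<in> parcs G. (u, w) \<in> parcs D \<longleftrightarrow> (w, u) \<notin> parcs D)"

text \<open>Since every edge occurs in both directions, the out-degree counts each neighbour once.\<close>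

definition vertex_degree :: "'v pair_pre_digraph \<Rightarrow> 'v \<Rightarrow> nat" where
  "vertex_degree G u = out_degree (with_proj G) u"

text \<open>
  The vertices are enumerated as \<open>v 0, \<dots>, v (n - 1)\<close>. Degrees are those of the undirected
  graph \<open>G\<close>; \<open>D\<close> is an orientation of \<open>G\<close>.
\<close>

definition skew_randic_matrix ::
  "'v pair_pre_digraph \<Rightarrow> 'v pair_pre_digraph \<Rightarrow> nat \<Rightarrow> (nat \<Rightarrow> 'v) \<Rightarrow> real mat" where
  "skew_randic_matrix G D n v = Matrix.mat n n (\<lambda>(i, j).
     let r = (real (vertex_degree G (v i)) * real (vertex_degree G (v j))) powr (- 1 / 2)
     in if (v i, v j) \<in> parcs D then r
        else if (v j, v i) \<in> parcs D then - r
        else 0)"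

text \<open>The complex eigenvalues, each repeated according to its algebraic multiplicity.\<close>

definition complex_eigenvalues :: "real mat \<Rightarrow> complex multiset" where
  "complex_eigenvalues A = proots (char_poly (map_mat complex_of_real A))"

text \<open>
  The weights \<open>cmod \<rho> / S\<close> are only meaningful if some eigenvalue is nonzero. Otherwise, that is,
  for a graph without edges, division by zero makes all of them, and hence the entropy, zero.
\<close>

definition skew_randic_entropy ::
  "'v pair_pre_digraph \<Rightarrow> 'v pair_pre_digraph \<Rightarrow> nat \<Rightarrow> (nat \<Rightarrow> 'v) \<Rightarrow> real" where
  "skew_randic_entropy G D n v =
     (let E = complex_eigenvalues (skew_randic_matrix G D n v);
          S = (\<Sum>\<rho>\<in>#E. cmod \<rho>)
      in \<Sum>\<rho>\<in>#E. (cmod \<rho> / S) * (1 - cmod \<rho> / S))"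

end

theory Submission
  imports
    Defs
    "HOL-Computational_Algebra.Fundamental_Theorem_Algebra"
begin

text \<open>
  The bound is a fact about probability vectors: for weights \<open>p\<^sub>1, \<dots>, p\<^sub>n\<close> with sum \<open>1\<close>, the
  quantity \<open>\<Sum> p\<^sub>i (1 - p\<^sub>i) = 1 - \<Sum> p\<^sub>i\<^sup>2\<close> is largest at the uniform vector, where it is
  \<open>1 - 1 / n\<close> (\<open>sum_mset_gini_le\<close>). The only spectral input is that there are exactly \<open>n\<close>
  weights: \<open>\<complex>\<close> is algebraically closed, so a complex polynomial of degree \<open>n\<close> has \<open>n\<close> roots
  with multiplicity.
\<close>

text \<open>
  The concave function \<open>x (1 - x)\<close> lies below its tangent at the uniform weight \<open>1 / n\<close>, and the
  sum of the tangent values depends only on the number of weights and on their total.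
\<close>

lemma sum_mset_gini_le:
  fixes f :: "'a \<Rightarrow> real"
  assumes "M \<noteq> {#}" and "(\<Sum>x\<in>#M. f x) = 1"
  shows "(\<Sum>x\<in>#M. f x * (1 - f x)) \<le> 1 - 1 / real (size M)"
proof -
  define n where "n = real (size M)"
  have n: "n > 0"
    using assms(1) by (simp add: n_def nonempty_has_size)
  have tangent: "t * (1 - t) \<le> (1 - 2 / n) * t + 1 / n ^ 2" for t :: real
    using zero_le_power2[of "t - 1 / n"]
    by (simp add: power2_eq_square algebra_simps)
  have "(\<Sum>x\<in>#M. f x * (1 - f x)) \<le> (\<Sum>x\<in>#M. (1 - 2 / n) * f x + 1 / n ^ 2)"
    by (intro sum_mset_mono tangent)
  also have "\<dots> = (1 - 2 / n) * (\<Sum>x\<in>#M. f x) + n * (1 / n ^ 2)"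
    by (simp add: sum_mset.distrib sum_mset_distrib_left multiset.map_comp o_def n_def)
  also have "\<dots> = 1 - 1 / n"
    using n by (simp add: assms(2) field_simps power2_eq_square)
  finally show ?thesis
    by (simp add: n_def)
qed

lemma size_complex_eigenvalues:
  assumes "A \<in> carrier_mat n n"
  shows "size (complex_eigenvalues A) = n"
  unfolding complex_eigenvalues_def
  using degree_monic_char_poly[of "map_mat complex_of_real A" n] assms
  by (simp add: size_proots_complex)

theorem corollary3p17:
  fixes G D :: "'v pair_pre_digraph" and v :: "nat \<Rightarrow> 'v" and n m :: nat
  assumes "pair_graph G"
    and "orientation G D"
    and "bij_betw v {..<n} (pverts G)"
    and "card (parcs D) = m"
  shows "skew_randic_entropy G D n v \<le> 1 - 1 / real n"
proof -
  define E where "E = complex_eigenvalues (skew_randic_matrix G D n v)"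
  define S where "S = (\<Sum>\<rho>\<in>#E. cmod \<rho>)"
  have entropy: "skew_randic_entropy G D n v = (\<Sum>\<rho>\<in>#E. (cmod \<rho> / S) * (1 - cmod \<rho> / S))"
    by (simp add: skew_randic_entropy_def E_def S_def Let_def)
  have size: "size E = n"
    unfolding E_def by (rule size_complex_eigenvalues) (simp add: skew_randic_matrix_def)
  show ?thesis
  proof (cases "S = 0")
    case True
    \<comment> \<open>All weights are \<open>0\<close> here, so the right-hand side only has to be nonnegative; for \<open>n = 0\<close>
      it is \<open>1\<close> because \<open>1 / 0 = 0\<close>.\<close>
    have "1 / real n \<le> 1"
      by (cases n) simp_all
    then show ?thesis
      using True by (simp add: entropy)
  next
    case False
    have "(\<Sum>\<rho>\<in>#E. cmod \<rho> / S) = (\<Sum>\<rho>\<in>#E. inverse S * cmod \<rho>)"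
      by (simp add: field_simps)
    also have "\<dots> = inverse S * S"
      by (simp add: S_def sum_mset_distrib_left multiset.map_comp o_def)
    also have "\<dots> = 1"
      using False by simp
    finally have "(\<Sum>\<rho>\<in>#E. cmod \<rho> / S) = 1" .
    moreover have "E \<noteq> {#}"
      using False by (auto simp: S_def)
    ultimately show ?thesis
      using sum_mset_gini_le[of E "\<lambda>\<rho>. cmod \<rho> / S"] by (simp add: entropy size)
  qed
qed

end
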